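(* Let $d\ge1$. For any measurable $f:\mathbb{T}^d\to[0,1]$, the measure $\mathbb{P}^f$ on point configurations on $\mathbb{Z}^d$ determines the value distribution of $f$. That is, if $f,g:\mathbb{T}^d\to[0,1]$ are measurable and $\mathbb{P}^f=\mathbb{P}^g$, then $f$ and $g$ have the same value distribution.
   Context: $\mathbb{T}^d=[0,1]^d$ (the $d$-dimensional torus), with normalized Lebesgue measure $\lambda_d$. For measurable $f:\mathbb{T}^d\to[0,1]$, let $\hat f(k)=\int_{\mathbb{T}^d}f(x)e^{-2\pi i k\cdot x}\,d\lambda_d(x)$, $k\in\mathbb{Z}^d$. $\mathbb{P}^f$ denotes the law of the determinantal point process on $\mathbb{Z}^d$ obtained from $f$, i.e. the law of the random subset of $\mathbb{Z}^d$ such that for all distinct $k_1,\dots,k_n\in\mathbb{Z}^d$ the probability that $k_1,\dots,k_n$ all belong to it is $\det\left(\hat f(k_i-k_j)\right)_{i,j=1}^n$. The value distribution of $f$ is the function $\nu_f(\xi)=\lambda_d(\{x\in\mathbb{T}^d:f(x)\ge\xi\})$. *)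

theory Defs
  imports
    "HOL-Probability.Probability"
    "Jordan_Normal_Form.Determinant"
begin

definition torus :: "(real ^ 'd) set" where
  "torus = cbox 0 1"

definition torus_measure :: "(real ^ 'd) measure" where
  "torus_measure = lebesgue_on torus"

definition fourier_coeff :: "(real ^ 'd \<Rightarrow> real) \<Rightarrow> int ^ 'd \<Rightarrow> complex" where
  "fourier_coeff f k =
     (LINT x|torus_measure.
        complex_of_real (f x) *
        exp (- 2 * complex_of_real pi * \<i> *
             complex_of_real (\<Sum>i\<in>UNIV. real_of_int (vec_nth k i) * vec_nth x i)))"

text \<open>Configurations are identified with subsets of the lattice. The sigma-algebra on them
  is the product one, generated by the events that a given site is occupied.\<close>

definition config_space :: "'a set measure" where
  "config_space = sigma UNIV (range (\<lambda>k. {S. k \<in> S}))"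

text \<open>Distinct sites are given as a distinct list, since the size of the matrix varies. Existence
  and uniqueness of such a law for measurable functions into the unit interval are not built in:
  the predicate says that a given measure is the law.\<close>

definition determinantal_law :: "(real ^ 'd \<Rightarrow> real) \<Rightarrow> (int ^ 'd) set measure \<Rightarrow> bool" where
  "determinantal_law f P \<longleftrightarrow>
     prob_space P \<and> space P = space config_space \<and> sets P = sets config_space \<and>
     (\<forall>ks :: (int ^ 'd) list. distinct ks \<longrightarrow>
        complex_of_real (measure P {S. set ks \<subseteq> S}) =
        Determinant.det (mat (length ks) (length ks)
          (\<lambda>(i, j). fourier_coeff f (ks ! i - ks ! j))))"

definition value_distribution :: "(real ^ 'd \<Rightarrow> real) \<Rightarrow> real \<Rightarrow> real" where
  "value_distribution f \<xi> = measure torus_measure {x \<in> torus. f x \<ge> \<xi>}"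

end

theory Submission
  imports Defs "HOL-Computational_Algebra.Formal_Power_Series"
begin

text \<open>The law determines the principal minors of the Toeplitz kernel \<open>K\<close> with entries
  \<open>fourier_coeff f (j - k)\<close>. Cramer's rule expresses the diagonal entries of the resolvent
  \<open>(1 - X K\<^sub>\<Lambda>)\<^sup>-\<^sup>1\<close> of a finite section, as a formal power series in \<open>X\<close>, as ratios of polynomials
  whose coefficients are sums of principal minors up to sign, so \<open>(K\<^sub>\<Lambda>\<^sup>m)(0, 0)\<close> is determined as
  well. With \<open>P\<^sub>\<Lambda>\<close> the \<open>L\<^sup>2\<close>-projection onto the characters in \<open>\<Lambda>\<close>, this entry is the integral
  of \<open>(P\<^sub>\<Lambda> f)\<^sup>m 1\<close>, where \<open>f\<close> acts by multiplication; this function converges to \<open>f\<^sup>m\<close> in \<open>L\<^sup>2\<close> as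
  \<open>\<Lambda>\<close> exhausts the lattice, by completeness of the characters. Hence all moments of \<open>f\<close> are
  determined, and by the Weierstrass theorem so is its distribution.\<close>

section \<open>Principal minors and finite sections\<close>

text \<open>The Leibniz formula over an arbitrary index set, so that minors of a lattice kernel are
  indexed by sets of sites without choosing an order.\<close>

definition perm_det :: "'a set \<Rightarrow> ('a \<Rightarrow> 'a \<Rightarrow> 'r::comm_ring_1) \<Rightarrow> 'r" where
  "perm_det S A = (\<Sum>p | p permutes S. of_int (sign p) * (\<Prod>i\<in>S. A i (p i)))"

text \<open>Conjugation with the enumeration of \<open>ks\<close> maps permutations of positions
  bijectively onto permutations of sites; it preserves the sign and only reorders the
  factors.\<close>

lemma det_mat_nth_eq_perm_det:
  assumes "distinct ks"
  shows "Determinant.det (mat (length ks) (length ks) (\<lambda>(i, j). A (ks ! i) (ks ! j))) =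
    perm_det (set ks) A"
proof -
  define n where "n = length ks"
  define \<phi> where "\<phi> = map_permutation {0..<n} (nth ks)"
  have bij: "bij_betw (nth ks) {0..<n} (set ks)"
    using assms bij_betw_nth[of ks "{0..<n}" "set ks"] by (auto simp: n_def lessThan_atLeast0)
  then have inj: "inj_on (nth ks) {0..<n}"
    by (simp add: bij_betw_def)
  have bij_perm: "bij_betw \<phi> {p. p permutes {0..<n}} {p. p permutes set ks}"
  proof (rule bij_betw_byWitness[where f' = "map_permutation (set ks) (inv_into {0..<n} (nth ks))"])
    show "\<forall>p\<in>{p. p permutes {0..<n}}.
        map_permutation (set ks) (inv_into {0..<n} (nth ks)) (\<phi> p) = p"
      unfolding \<phi>_def using bij inj
      by (auto intro!: map_permutation_compose_inv inv_into_f_f)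
    show "\<forall>p\<in>{p. p permutes set ks}.
        \<phi> (map_permutation (set ks) (inv_into {0..<n} (nth ks)) p) = p"
      unfolding \<phi>_def using bij
      by (auto intro!: map_permutation_compose_inv bij_betw_inv_into
          bij_betw_inv_into_right[OF bij])
    show "\<phi> ` {p. p permutes {0..<n}} \<subseteq> {p. p permutes set ks}"
      unfolding \<phi>_def using bij by (auto intro: map_permutation_permutes)
    show "map_permutation (set ks) (inv_into {0..<n} (nth ks)) ` {p. p permutes set ks}
        \<subseteq> {p. p permutes {0..<n}}"
      using bij by (auto intro: map_permutation_permutes bij_betw_inv_into)
  qed
  have "perm_det (set ks) A =
      (\<Sum>p | p permutes {0..<n}. of_int (sign (\<phi> p)) * (\<Prod>i\<in>set ks. A i (\<phi> p i)))"
    unfolding perm_det_def by (rule sum.reindex_bij_betw[OF bij_perm, symmetric])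
  also have "\<dots> = (\<Sum>p | p permutes {0..<n}.
      of_int (sign p) * (\<Prod>i = 0..<n. A (ks ! i) (ks ! p i)))"
  proof (rule sum.cong[OF refl])
    fix p assume "p \<in> {p. p permutes {0..<n}}"
    then have p: "p permutes {0..<n}" by simp
    have "(\<Prod>i\<in>set ks. A i (\<phi> p i)) = (\<Prod>i = 0..<n. A (ks ! i) (\<phi> p (ks ! i)))"
      by (rule prod.reindex_bij_betw[OF bij, symmetric])
    also have "\<dots> = (\<Prod>i = 0..<n. A (ks ! i) (ks ! p i))"
      unfolding \<phi>_def by (rule prod.cong) (auto simp: map_permutation_apply inj)
    finally show "of_int (sign (\<phi> p)) * (\<Prod>i\<in>set ks. A i (\<phi> p i)) =
        of_int (sign p) * (\<Prod>i = 0..<n. A (ks ! i) (ks ! p i))"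
      using sign_map_permutation[OF inj p] by (simp add: \<phi>_def)
  qed
  also have "\<dots> = Determinant.det (mat n n (\<lambda>(i, j). A (ks ! i) (ks ! j)))"
    unfolding Determinant.det_def
    by (auto intro!: sum.cong prod.cong simp: permutes_in_image dest: permutes_in_image)
  finally show ?thesis by (simp add: n_def)
qed

text \<open>When the product is multiplied out, \<open>T\<close> is the set of rows where the
  diagonal summand is chosen. The product over \<open>T\<close> vanishes unless \<open>p\<close>
  fixes \<open>T\<close> pointwise, so only permutations of \<open>S - T\<close> survive.\<close>

lemma perm_det_diag_add:
  assumes "finite S"
  shows "perm_det S (\<lambda>i j. (if i = j then d i else 0) + A i j) =
    (\<Sum>T\<in>Pow S. (\<Prod>i\<in>T. d i) * perm_det (S - T) A)"
proof -
  have "perm_det S (\<lambda>i j. (if i = j then d i else 0) + A i j) =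
    (\<Sum>p | p permutes S. \<Sum>T\<in>Pow S. of_int (sign p) *
       ((\<Prod>i\<in>T. if i = p i then d i else 0) * (\<Prod>i\<in>S - T. A i (p i))))"
    unfolding perm_det_def by (simp add: prod_add[OF assms] sum_distrib_left)
  also have "\<dots> = (\<Sum>T\<in>Pow S. \<Sum>p | p permutes S. of_int (sign p) *
       ((\<Prod>i\<in>T. if i = p i then d i else 0) * (\<Prod>i\<in>S - T. A i (p i))))"
    by (rule sum.swap)
  also have "\<dots> = (\<Sum>T\<in>Pow S. (\<Prod>i\<in>T. d i) * perm_det (S - T) A)"
  proof (rule sum.cong[OF refl])
    fix T assume "T \<in> Pow S"
    then have T: "T \<subseteq> S" by simp
    then have finT: "finite T" using assms finite_subset by auto
    have "(\<Sum>p | p permutes S. of_int (sign p) *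
        ((\<Prod>i\<in>T. if i = p i then d i else 0) * (\<Prod>i\<in>S - T. A i (p i)))) =
      (\<Sum>p | p permutes S - T. of_int (sign p) *
        ((\<Prod>i\<in>T. if i = p i then d i else 0) * (\<Prod>i\<in>S - T. A i (p i))))"
    proof (rule sum.mono_neutral_right)
      show "finite {p. p permutes S}" using assms by (rule finite_permutations)
      show "{p. p permutes S - T} \<subseteq> {p. p permutes S}"
        by (auto intro: permutes_subset)
      show "\<forall>p\<in>{p. p permutes S} - {p. p permutes S - T}. of_int (sign p) *
        ((\<Prod>i\<in>T. if i = p i then d i else 0) * (\<Prod>i\<in>S - T. A i (p i))) = 0"
      proof
        fix p assume p: "p \<in> {p. p permutes S} - {p. p permutes S - T}"
        then obtain x where "x \<in> T" "p x \<noteq> x"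
          using permutes_superset[of p S "S - T"] T by auto
        then have "(\<Prod>i\<in>T. if i = p i then d i else 0) = 0"
          using finT by (intro prod_zero) (auto intro!: bexI[of _ x])
        then show "of_int (sign p) *
          ((\<Prod>i\<in>T. if i = p i then d i else 0) * (\<Prod>i\<in>S - T. A i (p i))) = 0" by simp
      qed
    qed
    also have "\<dots> = (\<Sum>p | p permutes S - T. (\<Prod>i\<in>T. d i) *
        (of_int (sign p) * (\<Prod>i\<in>S - T. A i (p i))))"
    proof (rule sum.cong[OF refl])
      fix p assume "p \<in> {p. p permutes S - T}"
      then have "(\<Prod>i\<in>T. if i = p i then d i else 0) = (\<Prod>i\<in>T. d i)"
        by (intro prod.cong) (auto simp: permutes_not_in)
      then show "of_int (sign p) *
        ((\<Prod>i\<in>T. if i = p i then d i else 0) * (\<Prod>i\<in>S - T. A i (p i))) =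
        (\<Prod>i\<in>T. d i) * (of_int (sign p) * (\<Prod>i\<in>S - T. A i (p i)))"
        by (simp add: ac_simps)
    qed
    also have "\<dots> = (\<Prod>i\<in>T. d i) * perm_det (S - T) A"
      unfolding perm_det_def by (simp add: sum_distrib_left)
    finally show "(\<Sum>p | p permutes S. of_int (sign p) *
        ((\<Prod>i\<in>T. if i = p i then d i else 0) * (\<Prod>i\<in>S - T. A i (p i)))) =
      (\<Prod>i\<in>T. d i) * perm_det (S - T) A" .
  qed
  finally show ?thesis .
qed

text \<open>Cramer's rule for one component: replacing column \<open>a\<close> by the unit vector at
  \<open>a\<close> leaves a principal minor. The adjugate avoids division, so the rule is available
  over power series.\<close>

lemma perm_det_mult_solution:
  assumes fin: "finite S" and a: "a \<in> S"
    and sol: "\<And>i. i \<in> S \<Longrightarrow> (\<Sum>j\<in>S. A i j * v j) = (if i = a then 1 else 0)"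
  shows "perm_det S A * v a = perm_det (S - {a}) A"
proof -
  obtain ks where ks: "distinct ks" "set ks = S - {a}"
    using finite_distinct_list[of "S - {a}"] fin by blast
  \<comment> \<open>With \<open>a\<close> in front its index is 0: the adjugate entry used is the
    one at \<open>(0, 0)\<close>, with sign +1, and deleting row and column 0 leaves
    \<open>ks\<close>.\<close>
  define l where "l = a # ks"
  define n where "n = length l"
  have l: "distinct l" "set l = S" "n = Suc (length ks)"
    using ks a by (auto simp: l_def n_def)
  define M where "M = mat n n (\<lambda>(i, j). A (l ! i) (l ! j))"
  have M: "M \<in> carrier_mat n n" by (simp add: M_def)
  have bij: "bij_betw (nth l) {0..<n} S"
    using l bij_betw_nth[of l "{0..<n}" S] by (auto simp: n_def lessThan_atLeast0)
  have row: "(\<Sum>j = 0..<n. M $$ (i, j) * v (l ! j)) = (if i = 0 then 1 else 0)" if "i < n" for i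
  proof -
    have "(\<Sum>j = 0..<n. M $$ (i, j) * v (l ! j)) = (\<Sum>j = 0..<n. A (l ! i) (l ! j) * v (l ! j))"
      using that by (auto simp: M_def)
    also have "\<dots> = (\<Sum>j\<in>S. A (l ! i) j * v j)"
      by (rule sum.reindex_bij_betw[OF bij])
    also have "\<dots> = (if l ! i = a then 1 else 0)"
      using that l by (intro sol) (auto simp: n_def)
    also have "l ! i = a \<longleftrightarrow> i = 0"
      using nth_eq_iff_index_eq[of l i 0] l that by (simp add: n_def) (simp add: l_def)
    finally show ?thesis .
  qed
  have adjM: "adj_mat M \<in> carrier_mat n n" "adj_mat M * M = Determinant.det M \<cdot>\<^sub>m 1\<^sub>m n"
    using adj_mat[OF M] by auto
  have n0: "0 < n" by (simp add: l)
  have entry: "(\<Sum>i = 0..<n. adj_mat M $$ (0, i) * M $$ (i, j)) = (if j = 0 then Determinant.det M else 0)"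
    if "j < n" for j
  proof -
    have "(\<Sum>i = 0..<n. adj_mat M $$ (0, i) * M $$ (i, j)) = (adj_mat M * M) $$ (0, j)"
      using adjM(1) M n0 that by (simp add: scalar_prod_def)
    then show ?thesis using n0 that by (simp add: adjM(2))
  qed
  \<comment> \<open>Row 0 of \<open>adj_mat M * M\<close> applied to \<open>v\<close> is regrouped
    as row 0 of \<open>adj_mat M\<close> applied to the product of \<open>M\<close> and
    \<open>v\<close>, which is the first unit vector.\<close>
  have "Determinant.det M * v a =
      (\<Sum>j = 0..<n. (if j = 0 then Determinant.det M else 0) * v (l ! j))"
    using n0 by (simp add: if_distrib[of "\<lambda>x. x * _"] sum.delta' sum.delta cong: if_cong) (simp add: l_def)
  also have "\<dots> = (\<Sum>j = 0..<n. (\<Sum>i = 0..<n. adj_mat M $$ (0, i) * M $$ (i, j)) * v (l ! j))"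
    by (intro sum.cong refl) (simp add: entry)
  also have "\<dots> = (\<Sum>i = 0..<n. adj_mat M $$ (0, i) * (\<Sum>j = 0..<n. M $$ (i, j) * v (l ! j)))"
    by (simp add: sum_distrib_left sum_distrib_right mult.assoc) (rule sum.swap)
  also have "\<dots> = (\<Sum>i = 0..<n. adj_mat M $$ (0, i) * (if i = 0 then 1 else 0))"
    by (intro sum.cong refl) (simp add: row)
  also have "\<dots> = adj_mat M $$ (0, 0)"
    using n0 by (simp add: if_distrib[of "\<lambda>x. _ * x"] cong: if_cong)
  also have "\<dots> = Determinant.det (mat_delete M 0 0)"
    using M n0 by (simp add: adj_mat_def cofactor_def)
  also have "mat_delete M 0 0 = mat (length ks) (length ks) (\<lambda>(i, j). A (ks ! i) (ks ! j))"
    by (rule eq_matI) (auto simp: mat_delete_def M_def l l_def)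
  finally show ?thesis
    using det_mat_nth_eq_perm_det[OF l(1), of A] det_mat_nth_eq_perm_det[OF ks(1), of A]
    by (simp add: M_def n_def l ks)
qed

text \<open>For \<open>a\<close> and \<open>j\<close> in \<open>S\<close> this is the entry at
  \<open>(j, a)\<close> of the \<open>m\<close>-th power of the section of \<open>K\<close> to
  \<open>S\<close>, obtained by iterated action on the unit vector at \<open>a\<close>.\<close>

primrec window_iter :: "'a set \<Rightarrow> ('a \<Rightarrow> 'a \<Rightarrow> 'r::comm_ring_1) \<Rightarrow> 'a \<Rightarrow> nat \<Rightarrow> 'a \<Rightarrow> 'r" where
  "window_iter S K a 0 j = (if j = a then 1 else 0)"
| "window_iter S K a (Suc m) j = (\<Sum>k\<in>S. K j k * window_iter S K a m k)"

lemma fps_const_prod: "fps_const (\<Prod>i\<in>S. f i) = (\<Prod>i\<in>S. fps_const (f i :: 'r::comm_ring_1))"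
  by (induction S rule: infinite_finite_induct) (auto simp flip: fps_const_mult)

lemma fps_const_sum: "fps_const (\<Sum>i\<in>S. f i) = (\<Sum>i\<in>S. fps_const (f i :: 'r::comm_ring_1))"
  by (induction S rule: infinite_finite_induct) (auto simp flip: fps_const_add)

lemma fps_prod_nth_0: "fps_nth (\<Prod>i\<in>S. f i) 0 = (\<Prod>i\<in>S. fps_nth (f i :: 'r::comm_ring_1 fps) 0)"
  by (induction S rule: infinite_finite_induct) auto

lemma perm_det_fps_scale:
  "perm_det S (\<lambda>i j. c * fps_const (K i j)) = c ^ card S * fps_const (perm_det S K)"
proof -
  have "fps_const (perm_det S K) =
     (\<Sum>p | p permutes S. of_int (sign p) * (\<Prod>i\<in>S. fps_const (K i (p i))))"
    by (simp add: perm_det_def fps_const_sum fps_const_prod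
        flip: fps_const_mult fps_of_int)
  then show ?thesis
    by (simp add: perm_det_def prod.distrib sum_distrib_left ac_simps)
qed

text \<open>Taking constant coefficients is multiplicative and turns \<open>A\<close> into the
  identity matrix. This is what makes the determinant of \<open>1 - X K\<close> nonzero.\<close>

lemma perm_det_fps_nth_0:
  fixes A :: "'a \<Rightarrow> 'a \<Rightarrow> 'r::comm_ring_1 fps"
  assumes "finite S" and "\<And>i j. fps_nth (A i j) 0 = (if i = j then 1 else 0)"
  shows "fps_nth (perm_det S A) 0 = 1"
proof -
  have "fps_nth (perm_det S A) 0 =
      (\<Sum>p | p permutes S. of_int (sign p) * (\<Prod>i\<in>S. if i = p i then 1 else 0))"
    by (simp add: perm_det_def fps_sum_nth fps_prod_nth_0 assms(2) fps_of_int[symmetric])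
  also have "\<dots> = (\<Sum>p\<in>{id}. of_int (sign p) * (\<Prod>i\<in>S. if i = p i then 1 else 0))"
  proof (rule sum.mono_neutral_right)
    show "finite {p. p permutes S}" using assms(1) by (rule finite_permutations)
    show "{id} \<subseteq> {p. p permutes S}" by (simp add: permutes_id)
    show "\<forall>p\<in>{p. p permutes S} - {id}. of_int (sign p) *
        (\<Prod>i\<in>S. if i = p i then 1 else (0::'r)) = 0"
    proof
      fix p assume p: "p \<in> {p. p permutes S} - {id}"
      then obtain x where "p x \<noteq> x" by (auto simp: fun_eq_iff)
      moreover have "x \<in> S" using p \<open>p x \<noteq> x\<close> by (auto simp: permutes_not_in)
      ultimately have "(\<Prod>i\<in>S. if i = p i then 1 else (0::'r)) = 0"
        using assms(1) by (intro prod_zero) (auto intro!: bexI[of _ x])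
      then show "of_int (sign p) * (\<Prod>i\<in>S. if i = p i then 1 else (0::'r)) = 0" by simp
    qed
  qed
  finally show ?thesis by simp
qed

text \<open>Power series over an integral domain have no zero divisors, so Cramer's identity for the
  resolvent determines its entry at \<open>a\<close>; both determinants in it expand into principal
  minors.\<close>

lemma window_iter_eq_of_perm_det_eq:
  fixes K K' :: "'a \<Rightarrow> 'a \<Rightarrow> 'r::idom"
  assumes fin: "finite S" and a: "a \<in> S"
    and minors: "\<And>T. T \<subseteq> S \<Longrightarrow> perm_det T K = perm_det T K'"
  shows "window_iter S K a m a = window_iter S K' a m a"
proof -
  \<comment> \<open>\<open>A K\<close> is the matrix \<open>1 - X K\<close>, and \<open>G K\<close>
    is column \<open>a\<close> of its Neumann series, entry by entry.\<close>
  define A where "A K i j = (if i = j then 1 else 0) + - fps_X * fps_const (K i j)"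
    for K :: "'a \<Rightarrow> 'a \<Rightarrow> 'r" and i j
  define G where "G K j = Abs_fps (\<lambda>m. window_iter S K a m j)" for K :: "'a \<Rightarrow> 'a \<Rightarrow> 'r" and j
  have resolvent: "(\<Sum>j\<in>S. A K i j * G K j) = (if i = a then 1 else 0)" if "i \<in> S" for K i
  proof -
    have "(\<Sum>j\<in>S. A K i j * G K j) =
      (\<Sum>j\<in>S. (if i = j then G K j else 0)) - fps_X * (\<Sum>j\<in>S. fps_const (K i j) * G K j)"
      unfolding A_def sum_distrib_left sum_subtractf[symmetric]
      by (intro sum.cong refl) (simp add: algebra_simps)
    also have "(\<Sum>j\<in>S. (if i = j then G K j else 0)) = G K i"
      using fin that by simp
    also have "G K i - fps_X * (\<Sum>j\<in>S. fps_const (K i j) * G K j) = (if i = a then 1 else 0)"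
    proof (rule fps_ext)
      fix m show "fps_nth (G K i - fps_X * (\<Sum>j\<in>S. fps_const (K i j) * G K j)) m =
         fps_nth (if i = a then 1 else 0) m"
        by (cases m) (auto simp: G_def fps_sum_nth)
    qed
    finally show ?thesis .
  qed
  \<comment> \<open>\<open>U\<close> collects the sites that contribute the diagonal 1; each
    remaining site carries one factor \<open>- fps_X\<close>.\<close>
  have expand: "perm_det T (A K) =
      (\<Sum>U\<in>Pow T. (- fps_X) ^ card (T - U) * fps_const (perm_det (T - U) K))" if "T \<subseteq> S" for T K
    unfolding A_def perm_det_diag_add[OF finite_subset[OF that fin], of "\<lambda>_. 1"]
      perm_det_fps_scale by simp
  have A_eq: "perm_det T (A K) = perm_det T (A K')" if "T \<subseteq> S" for T
  proof -
    have "perm_det (T - U) K = perm_det (T - U) K'" for U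
      using that by (intro minors) auto
    then show ?thesis by (simp add: expand that)
  qed
  have "fps_nth (perm_det S (A K')) 0 = 1"
    by (rule perm_det_fps_nth_0[OF fin]) (simp add: A_def)
  then have nz: "perm_det S (A K') \<noteq> 0" by auto
  have "perm_det S (A K) * G K a = perm_det S (A K') * G K' a"
    using perm_det_mult_solution[OF fin a resolvent] A_eq[of "S - {a}"] by auto
  then have "G K a = G K' a"
    using nz A_eq[of S] by simp
  then have "fps_nth (G K a) m = fps_nth (G K' a) m" by simp
  then show ?thesis by (simp add: G_def)
qed

section \<open>Characters of the torus\<close>

lemma space_torus_measure [simp]: "space torus_measure = torus"
  by (simp add: torus_measure_def)

lemma torus_sets [measurable]: "torus \<in> sets lebesgue"
  by (simp add: torus_def)

lemma mem_torus: "x \<in> torus \<longleftrightarrow> (\<forall>i. 0 \<le> vec_nth x i \<and> vec_nth x i \<le> 1)"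
  by (auto simp: torus_def mem_box_cart)

lemma one_inner_Basis: "b \<in> Basis \<Longrightarrow> inner (1 :: real ^ 'd) b = 1"
  by (auto simp: Basis_vec_def inner_axis)

interpretation torus: prob_space "torus_measure :: (real ^ 'd) measure"
proof
  have "emeasure lebesgue (torus :: (real ^ 'd) set) = 1"
    by (simp add: torus_def emeasure_lborel_cbox_eq one_inner_Basis)
  then show "emeasure (torus_measure :: (real ^ 'd) measure) (space torus_measure) = 1"
    by (simp add: torus_measure_def emeasure_restrict_space)
qed

definition character :: "int ^ 'd \<Rightarrow> real ^ 'd \<Rightarrow> complex" where
  "character k x = cis (2 * pi * (\<Sum>i\<in>UNIV. real_of_int (vec_nth k i) * vec_nth x i))"

lemma norm_character [simp]: "cmod (character k x) = 1"
  by (simp add: character_def)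

lemma character_0 [simp]: "character 0 x = 1"
  by (simp add: character_def)

lemma character_add: "character (k + l) x = character k x * character l x"
  by (simp add: character_def cis_mult sum.distrib algebra_simps)

lemma cnj_character: "cnj (character k x) = character (- k) x"
  by (simp add: character_def cis_cnj sum_negf)

lemma continuous_on_character [continuous_intros]: "continuous_on A (character k)"
  unfolding character_def by (intro continuous_intros)

text \<open>For \<open>n \<noteq> 0\<close> the antiderivative takes equal values at 0 and 1 by
  periodicity. The form with the indicator on the whole line also records integrability, which the
  product formula requires.\<close>

lemma integral_cis_unit_interval:
  "has_bochner_integral lborel (\<lambda>t. indicator {0..1} t *\<^sub>R cis (2 * pi * real_of_int n * t))
     (if n = 0 then 1 else 0)"
proof (cases "n = 0")
  case True
  have "has_bochner_integral lborel (\<lambda>t::real. indicator {0..1} t *\<^sub>R (1::complex)) (of_real 1 - of_real 0)"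
    using has_bochner_integral_FTC_Icc[of 0 1 complex_of_real "\<lambda>_. 1"]
    by (auto intro!: derivative_eq_intros simp: has_vector_derivative_def scaleR_conv_of_real)
  then show ?thesis using True by simp
next
  case False
  define c where "c = 2 * pi * real_of_int n"
  have c: "c \<noteq> 0" using False by (simp add: c_def)
  have "has_bochner_integral lborel (\<lambda>t. indicator {0..1} t *\<^sub>R cis (c * t))
      (cis (c * 1) / (\<i> * c) - cis (c * 0) / (\<i> * c))"
  proof (rule has_bochner_integral_FTC_Icc)
    fix t :: real
    have "((\<lambda>t. exp (\<i> * c * of_real t) / (\<i> * c)) has_vector_derivative exp (\<i> * c * of_real t)) (at t within {0..1})"
      using c by (auto intro!: derivative_eq_intros has_vector_derivative_real_field)
    then show "((\<lambda>t. cis (c * t) / (\<i> * c)) has_vector_derivative cis (c * t)) (at t within {0..1})"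
      by (simp add: cis_conv_exp mult.assoc)
  qed (auto intro!: continuous_intros)
  moreover have "cis c = 1"
    by (simp add: c_def cis_multiple_2pi)
  ultimately show ?thesis using False by (simp add: c_def)
qed

lemma inner_int_axis:
  "inner (\<chi> i. real_of_int (vec_nth k i)) (axis i 1) = real_of_int (vec_nth k i)"
  by (simp add: inner_axis)

text \<open>Fubini: on the cube the character factors over the coordinates, and a coordinate where
  \<open>k\<close> is nonzero contributes a vanishing integral.\<close>

lemma integral_character:
  fixes k :: "int ^ 'd"
  shows "(LINT x|torus_measure. character k x) = (if k = 0 then 1 else 0)"
proof (cases "k = 0")
  case True
  then show ?thesis using torus.prob_space[where 'd = 'd] by simp
next
  case False
  define w :: "real ^ 'd" where "w = (\<chi> i. real_of_int (vec_nth k i))"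
  have w: "\<exists>n. inner w b = real_of_int n" if b: "b \<in> Basis" for b
    using b by (auto simp: Basis_vec_def w_def inner_int_axis)
  \<comment> \<open>The cutoff to the unit interval is part of each factor, so the product over the
    coordinates also produces the indicator of the cube.\<close>
  define \<psi> where "\<psi> b t = indicator {0..1} t *\<^sub>R cis (2 * pi * inner w b * t)" for b and t :: real
  have \<psi>: "integrable lborel (\<psi> b)" if b: "b \<in> Basis" for b
    using w[OF b] integral_cis_unit_interval unfolding \<psi>_def by (auto simp: has_bochner_integral_iff)
  obtain i where i: "vec_nth k i \<noteq> 0" using False by (auto simp: Finite_Cartesian_Product.vec_eq_iff)
  have \<psi>0: "integral\<^sup>L lborel (\<psi> (axis i 1)) = 0"
    using integral_cis_unit_interval[of "vec_nth k i"] i unfolding \<psi>_def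
    by (auto simp: has_bochner_integral_iff w_def inner_int_axis)
  have prod: "indicator torus x *\<^sub>R character k x = (\<Prod>b\<in>Basis. \<psi> b (inner x b))" for x :: "real ^ 'd"
  proof -
    have "(\<Sum>i\<in>UNIV. real_of_int (vec_nth k i) * vec_nth x i) = inner w x"
      by (simp add: inner_vec_def w_def)
    also have "\<dots> = (\<Sum>b\<in>Basis. inner w b * inner x b)"
      by (rule euclidean_inner)
    finally have "character k x = exp (\<Sum>b\<in>Basis. \<i> * of_real (2 * pi * inner w b * inner x b))"
      by (simp add: character_def cis_conv_exp sum_distrib_left mult.assoc)
    also have "\<dots> = (\<Prod>b\<in>Basis. cis (2 * pi * inner w b * inner x b))"
      by (simp add: exp_sum cis_conv_exp)
    finally have ch: "character k x = (\<Prod>b\<in>Basis. cis (2 * pi * inner w b * inner x b))" .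
    have "(\<Prod>b\<in>Basis. indicator {0..1} (inner x b)) = (indicator torus x :: real)"
    proof (cases "x \<in> torus")
      case True
      then show ?thesis by (auto simp: torus_def mem_box one_inner_Basis intro!: prod.neutral)
    next
      case False
      then obtain b :: "real ^ 'd" where "b \<in> Basis" "inner x b \<notin> {0..1}"
        by (auto simp: torus_def mem_box one_inner_Basis)
      then have "(\<Prod>b\<in>Basis. indicator {0..1} (inner x b)) = (0 :: real)"
        by (intro prod_zero) (auto intro!: bexI[of _ b])
      then show ?thesis using False by simp
    qed
    then show ?thesis
      by (simp add: \<psi>_def ch scaleR_conv_of_real prod.distrib flip: of_real_prod)
  qed
  interpret product_sigma_finite "\<lambda>_ :: real ^ 'd. lborel :: real measure" ..
  have [measurable]: "character k \<in> borel_measurable borel"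
    by (intro borel_measurable_continuous_onI continuous_intros)
  have [measurable]: "torus \<in> sets (borel :: (real ^ 'd) measure)"
    by (simp add: torus_def)
  have [measurable]: "(\<lambda>f. \<Sum>b\<in>Basis. f b *\<^sub>R b) \<in> (\<Pi>\<^sub>M b\<in>(Basis :: (real ^ 'd) set). lborel) \<rightarrow>\<^sub>M borel"
    by measurable
  have "(LINT x|torus_measure. character k x) = (LINT x|lebesgue. indicator torus x *\<^sub>R character k x)"
    unfolding torus_measure_def by (rule integral_restrict_space) simp
  also have "\<dots> = (LINT x|lborel. indicator torus x *\<^sub>R character k x)"
    by (rule integral_completion) measurable
  also have "\<dots> = (LINT f|(\<Pi>\<^sub>M b\<in>(Basis :: (real ^ 'd) set). lborel).
      indicator torus (\<Sum>b\<in>Basis. f b *\<^sub>R b) *\<^sub>R character k (\<Sum>b\<in>Basis. f b *\<^sub>R b))"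
    by (subst lborel_eq, subst integral_distr) measurable
  also have "\<dots> = (LINT f|(\<Pi>\<^sub>M b\<in>(Basis :: (real ^ 'd) set). lborel). (\<Prod>b\<in>Basis. \<psi> b (f b)))"
    by (simp add: prod cong: prod.cong)
  also have "\<dots> = (\<Prod>b\<in>Basis. integral\<^sup>L lborel (\<psi> b))"
    by (rule product_integral_prod) (use \<psi> in auto)
  also have "\<dots> = 0"
    using \<psi>0 by (intro prod_zero) (auto intro!: bexI[of _ "axis i 1"] simp: axis_in_Basis_iff)
  finally show ?thesis using False by simp
qed

text \<open>A class closed under sums, products and conjugation, so that the integrands of the L2
  theory are integrable by one rule; square integrability alone is not preserved by
  products.\<close>

definition bounded_measurable :: "(real ^ 'd \<Rightarrow> complex) \<Rightarrow> bool" where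
  "bounded_measurable u \<longleftrightarrow>
     u \<in> borel_measurable torus_measure \<and> (\<exists>B. \<forall>x\<in>torus. cmod (u x) \<le> B)"

named_theorems bm_intros

lemma bounded_measurable_integrable:
  assumes "bounded_measurable u"
  shows "integrable torus_measure u"
proof -
  obtain B where "\<forall>x\<in>torus. cmod (u x) \<le> B"
    using assms by (auto simp: bounded_measurable_def)
  then show ?thesis
    using assms by (intro torus.integrable_const_bound[where B = B] AE_I2)
      (auto simp: bounded_measurable_def)
qed

lemma bounded_measurable_const [bm_intros]: "bounded_measurable (\<lambda>_. c)"
  by (auto simp: bounded_measurable_def)

lemma bounded_measurable_add [bm_intros]:
  assumes "bounded_measurable u" "bounded_measurable v"
  shows "bounded_measurable (\<lambda>x. u x + v x)"
proof -
  obtain A B where "\<forall>x\<in>torus. cmod (u x) \<le> A" "\<forall>x\<in>torus. cmod (v x) \<le> B"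
    using assms by (auto simp: bounded_measurable_def)
  then have "\<forall>x\<in>torus. cmod (u x + v x) \<le> A + B"
    by (auto intro: norm_triangle_mono)
  then show ?thesis using assms by (auto simp: bounded_measurable_def)
qed

lemma bounded_measurable_mult [bm_intros]:
  assumes "bounded_measurable u" "bounded_measurable v"
  shows "bounded_measurable (\<lambda>x. u x * v x)"
proof -
  obtain A B where "\<forall>x\<in>torus. cmod (u x) \<le> A" "\<forall>x\<in>torus. cmod (v x) \<le> B"
    using assms by (auto simp: bounded_measurable_def)
  then have "\<forall>x\<in>torus. cmod (u x * v x) \<le> A * B"
    by (auto simp: norm_mult intro!: mult_mono' )
  then show ?thesis using assms by (auto simp: bounded_measurable_def)
qed

lemma bounded_measurable_diff [bm_intros]:
  assumes "bounded_measurable u" "bounded_measurable v"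
  shows "bounded_measurable (\<lambda>x. u x - v x)"
  using bounded_measurable_add[OF assms(1) bounded_measurable_mult[OF bounded_measurable_const[of "-1"] assms(2)]]
  by simp

lemma bounded_measurable_cnj [bm_intros]: "bounded_measurable u \<Longrightarrow> bounded_measurable (\<lambda>x. cnj (u x))"
  by (auto simp: bounded_measurable_def
      intro: measurable_compose[OF _ borel_measurable_continuous_onI[OF continuous_on_cnj[OF continuous_on_id]]])

lemma bounded_measurable_sum [bm_intros]:
  "(\<And>i. i \<in> I \<Longrightarrow> bounded_measurable (u i)) \<Longrightarrow> bounded_measurable (\<lambda>x. \<Sum>i\<in>I. u i x)"
  by (induction I rule: infinite_finite_induct) (auto intro: bm_intros)

lemma bounded_measurable_character [bm_intros]: "bounded_measurable (character k)"
proof -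
  have "character k \<in> borel_measurable borel"
    by (intro borel_measurable_continuous_onI continuous_intros)
  then have "character k \<in> borel_measurable lborel" by simp
  then have "character k \<in> borel_measurable torus_measure"
    unfolding torus_measure_def by (intro measurable_restrict_space1 measurable_completion)
  then show ?thesis by (auto simp: bounded_measurable_def intro!: exI[of _ 1])
qed

lemma bounded_measurable_of_real:
  assumes "f \<in> borel_measurable torus_measure" "f ` torus \<subseteq> {0..1}"
  shows "bounded_measurable (\<lambda>x. complex_of_real (f x))"
  using assms by (auto simp: bounded_measurable_def intro!: exI[of _ 1])

section \<open>Inner product, projections and Bessel's inequality\<close>

definition torus_inner :: "(real ^ 'd \<Rightarrow> complex) \<Rightarrow> (real ^ 'd \<Rightarrow> complex) \<Rightarrow> complex" where
  "torus_inner u v = (LINT x|torus_measure. u x * cnj (v x))"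

definition sq_norm :: "(real ^ 'd \<Rightarrow> complex) \<Rightarrow> real" where
  "sq_norm u = (LINT x|torus_measure. (cmod (u x))\<^sup>2)"

lemma fourier_coeff_eq_inner:
  "fourier_coeff f k = torus_inner (\<lambda>x. complex_of_real (f x)) (character k)"
  unfolding fourier_coeff_def torus_inner_def
  by (intro Bochner_Integration.integral_cong refl)
     (simp add: character_def cis_conv_exp mult_ac exp_cnj)

lemma of_real_cmod_sq: "(complex_of_real (cmod z))\<^sup>2 = z * cnj z"
  using complex_norm_square[of z] by simp

lemma sq_norm_eq_inner: "complex_of_real (sq_norm u) = torus_inner u u"
  by (simp add: sq_norm_def torus_inner_def of_real_cmod_sq flip: integral_complex_of_real)

lemma integrable_sq_norm:
  assumes "bounded_measurable u"
  shows "integrable torus_measure (\<lambda>x. (cmod (u x))\<^sup>2)"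
proof -
  have "integrable torus_measure (\<lambda>x. u x * cnj (u x))"
    by (intro bounded_measurable_integrable bm_intros assms)
  then have "integrable torus_measure (\<lambda>x. complex_of_real ((cmod (u x))\<^sup>2))"
    by (simp add: of_real_cmod_sq)
  then show ?thesis by (simp only: complex_of_real_integrable_eq)
qed

lemma torus_inner_cnj: "cnj (torus_inner u v) = torus_inner v u"
  by (simp add: torus_inner_def mult.commute del: Bochner_Integration.integral_cnj flip: Bochner_Integration.integral_cnj)

lemma torus_inner_diff_left:
  assumes "bounded_measurable u" "bounded_measurable v" "bounded_measurable w"
  shows "torus_inner (\<lambda>x. u x - v x) w = torus_inner u w - torus_inner v w"
proof -
  have "integrable torus_measure (\<lambda>x. u x * cnj (w x))" "integrable torus_measure (\<lambda>x. v x * cnj (w x))"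
    by (intro bounded_measurable_integrable bm_intros assms)+
  then show ?thesis by (simp add: torus_inner_def algebra_simps)
qed

lemma torus_inner_add_left:
  assumes "bounded_measurable u" "bounded_measurable v" "bounded_measurable w"
  shows "torus_inner (\<lambda>x. u x + v x) w = torus_inner u w + torus_inner v w"
proof -
  have "integrable torus_measure (\<lambda>x. u x * cnj (w x))" "integrable torus_measure (\<lambda>x. v x * cnj (w x))"
    by (intro bounded_measurable_integrable bm_intros assms)+
  then show ?thesis by (simp add: torus_inner_def algebra_simps)
qed

lemma torus_inner_cmult_left: "torus_inner (\<lambda>x. c * u x) w = c * torus_inner u w"
  by (simp add: torus_inner_def mult.assoc)

lemma torus_inner_sum_left:
  assumes "\<And>i. i \<in> I \<Longrightarrow> bounded_measurable (u i)" "bounded_measurable w"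
  shows "torus_inner (\<lambda>x. \<Sum>i\<in>I. u i x) w = (\<Sum>i\<in>I. torus_inner (u i) w)"
  using assms(1)
  by (induction I rule: infinite_finite_induct)
     (auto simp: torus_inner_add_left bm_intros assms(2), auto simp: torus_inner_def)

lemma torus_inner_characters: "torus_inner (character k) (character l) = (if k = l then 1 else 0)"
  by (simp add: torus_inner_def cnj_character integral_character flip: character_add)

text \<open>By orthonormality, the L2-projection onto the span of the characters in a finite
  \<open>\<Lambda>\<close>. For infinite \<open>\<Lambda>\<close> the sum has the default value 0,
  so the result is bounded and measurable in every case.\<close>

definition proj :: "(int ^ 'd) set \<Rightarrow> (real ^ 'd \<Rightarrow> complex) \<Rightarrow> real ^ 'd \<Rightarrow> complex" where
  "proj \<Lambda> u x = (\<Sum>k\<in>\<Lambda>. torus_inner u (character k) * character k x)"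

lemma bounded_measurable_proj [bm_intros]: "bounded_measurable (proj \<Lambda> u)"
  unfolding proj_def by (intro bm_intros)

lemma torus_inner_proj_left:
  assumes "bounded_measurable v"
  shows "torus_inner (proj \<Lambda> u) v =
    (\<Sum>k\<in>\<Lambda>. torus_inner u (character k) * cnj (torus_inner v (character k)))"
  unfolding proj_def
  by (simp add: torus_inner_sum_left torus_inner_cmult_left torus_inner_cnj bm_intros assms)

lemma torus_inner_proj_character:
  assumes "finite \<Lambda>"
  shows "torus_inner (proj \<Lambda> u) (character l) = (if l \<in> \<Lambda> then torus_inner u (character l) else 0)"
  using assms
  by (simp add: torus_inner_proj_left bm_intros torus_inner_characters if_distrib cong: if_cong)

lemma sq_norm_nonneg: "0 \<le> sq_norm u"
  by (simp add: sq_norm_def)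

lemma sq_norm_proj:
  assumes "finite \<Lambda>"
  shows "sq_norm (proj \<Lambda> u) = (\<Sum>k\<in>\<Lambda>. (cmod (torus_inner u (character k)))\<^sup>2)"
proof -
  have "complex_of_real (sq_norm (proj \<Lambda> u)) =
      complex_of_real (\<Sum>k\<in>\<Lambda>. (cmod (torus_inner u (character k)))\<^sup>2)"
    using assms
    by (simp add: sq_norm_eq_inner torus_inner_proj_left[OF bounded_measurable_proj] torus_inner_proj_character
        of_real_cmod_sq)
  then show ?thesis by (simp only: of_real_eq_iff)
qed

text \<open>Pythagoras: both mixed inner products of \<open>u\<close> with its projection equal the
  squared norm of the projection.\<close>

lemma sq_norm_diff_proj:
  assumes fin: "finite \<Lambda>" and u: "bounded_measurable u"
  shows "sq_norm (\<lambda>x. u x - proj \<Lambda> u x) = sq_norm u - sq_norm (proj \<Lambda> u)"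
proof -
  let ?P = "proj \<Lambda> u"
  have Pu: "torus_inner ?P u = complex_of_real (sq_norm ?P)"
    by (simp add: sq_norm_proj fin torus_inner_proj_left u of_real_cmod_sq)
  have uP: "torus_inner u ?P = complex_of_real (sq_norm ?P)"
    using Pu torus_inner_cnj[of ?P u] by simp
  have right: "torus_inner v (\<lambda>x. u x - ?P x) = torus_inner v u - torus_inner v ?P"
    if v: "bounded_measurable v" for v
    using torus_inner_diff_left[OF u bounded_measurable_proj v, of \<Lambda> u]
    by (metis complex_cnj_diff torus_inner_cnj)
  have "torus_inner (\<lambda>x. u x - ?P x) (\<lambda>x. u x - ?P x) =
      torus_inner u u - torus_inner u ?P - (torus_inner ?P u - torus_inner ?P ?P)"
    by (simp add: torus_inner_diff_left right u bm_intros)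
  then have "complex_of_real (sq_norm (\<lambda>x. u x - ?P x)) = complex_of_real (sq_norm u - sq_norm ?P)"
    by (simp add: Pu uP flip: sq_norm_eq_inner)
  then show ?thesis by (simp only: of_real_eq_iff)
qed

lemma sq_norm_proj_le:
  assumes "finite \<Lambda>" "bounded_measurable u"
  shows "sq_norm (proj \<Lambda> u) \<le> sq_norm u"
  using sq_norm_diff_proj[OF assms] sq_norm_nonneg[of "\<lambda>x. u x - proj \<Lambda> u x"] by simp

lemma sq_norm_diff_proj_le:
  assumes "finite \<Lambda>" "bounded_measurable u"
  shows "sq_norm (\<lambda>x. u x - proj \<Lambda> u x) \<le> sq_norm u"
  using sq_norm_diff_proj[OF assms] sq_norm_nonneg[of "proj \<Lambda> u"] by simp

text \<open>Bessel's inequality for the single trivial character, whose coefficient is the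
  integral.\<close>

lemma norm_integral_le_sq_norm:
  assumes "bounded_measurable u"
  shows "(cmod (LINT x|torus_measure. u x))\<^sup>2 \<le> sq_norm u"
  using sq_norm_proj_le[OF _ assms, of "{0}"] by (simp add: sq_norm_proj torus_inner_def)

lemma sq_norm_mono:
  assumes "bounded_measurable u" "bounded_measurable v"
    and "\<And>x. x \<in> torus \<Longrightarrow> cmod (u x) \<le> cmod (v x)"
  shows "sq_norm u \<le> sq_norm v"
  unfolding sq_norm_def
  using assms by (intro integral_mono integrable_sq_norm) (auto intro: power_mono)

text \<open>Integrates the pointwise bound for squares. It stands in for the triangle inequality;
  the factor 2 is harmless for limits at 0.\<close>

lemma sq_norm_add_le:
  assumes "bounded_measurable u" "bounded_measurable v"
  shows "sq_norm (\<lambda>x. u x + v x) \<le> 2 * sq_norm u + 2 * sq_norm v"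
proof -
  have *: "(cmod (a + b))\<^sup>2 \<le> 2 * (cmod a)\<^sup>2 + 2 * (cmod b)\<^sup>2" for a b
  proof -
    have "(cmod (a + b))\<^sup>2 \<le> (cmod a + cmod b)\<^sup>2"
      by (intro power_mono norm_triangle_ineq) auto
    also have "\<dots> \<le> 2 * (cmod a)\<^sup>2 + 2 * (cmod b)\<^sup>2"
      using sum_squares_bound[of "cmod a" "cmod b"] by (simp add: power2_sum)
    finally show ?thesis .
  qed
  have int: "integrable torus_measure (\<lambda>x. (cmod (u x))\<^sup>2)" "integrable torus_measure (\<lambda>x. (cmod (v x))\<^sup>2)"
    "integrable torus_measure (\<lambda>x. (cmod (u x + v x))\<^sup>2)"
    using assms by (simp_all add: integrable_sq_norm bounded_measurable_add)
  have "sq_norm (\<lambda>x. u x + v x) \<le> (LINT x|torus_measure. 2 * (cmod (u x))\<^sup>2 + 2 * (cmod (v x))\<^sup>2)"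
    unfolding sq_norm_def using int by (intro integral_mono *) simp_all
  also have "\<dots> = 2 * sq_norm u + 2 * sq_norm v"
    unfolding sq_norm_def using assms by (simp add: integrable_sq_norm)
  finally show ?thesis .
qed

section \<open>Trigonometric polynomials\<close>

inductive trig_poly :: "(real ^ 'd \<Rightarrow> complex) \<Rightarrow> bool" where
  character: "trig_poly (character k)"
| cmult: "trig_poly p \<Longrightarrow> trig_poly (\<lambda>x. c * p x)"
| add: "trig_poly p \<Longrightarrow> trig_poly q \<Longrightarrow> trig_poly (\<lambda>x. p x + q x)"

lemma trig_poly_bounded_measurable: "trig_poly p \<Longrightarrow> bounded_measurable p"
  by (induction rule: trig_poly.induct) (auto intro!: bm_intros)

lemma trig_poly_const: "trig_poly (\<lambda>_. c)"
  using trig_poly.cmult[OF trig_poly.character[of 0], of c] by simp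

lemma trig_poly_mult:
  assumes "trig_poly p" "trig_poly q"
  shows "trig_poly (\<lambda>x. p x * q x)"
  using assms(1)
proof (induction rule: trig_poly.induct)
  case (character k)
  show ?case using assms(2)
  proof (induction rule: trig_poly.induct)
    case (character l)
    then show ?case using trig_poly.character[of "k + l"] by (simp add: character_add[abs_def])
  next
    case (cmult p c)
    then show ?case using trig_poly.cmult[OF cmult.IH, of c] by (simp add: mult_ac)
  next
    case (add p q)
    then show ?case using trig_poly.add[OF add.IH] by (simp add: distrib_left)
  qed
next
  case (cmult p c)
  then show ?case using trig_poly.cmult[OF cmult.IH, of c] by (simp add: mult_ac)
next
  case (add p q)
  then show ?case using trig_poly.add[OF add.IH] by (simp add: distrib_right)
qed

text \<open>A trigonometric polynomial has finitely many frequencies and is fixed by the projection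
  once \<open>\<Lambda>\<close> contains them. The filter of finite sets spares the induction from
  naming these frequencies.\<close>

lemma eventually_proj_trig_poly:
  assumes "trig_poly p"
  shows "eventually (\<lambda>\<Lambda>. proj \<Lambda> p = p) (finite_subsets_at_top UNIV)"
  using assms
proof (induction rule: trig_poly.induct)
  case (character k)
  show ?case
    unfolding eventually_finite_subsets_at_top
    by (rule exI[of _ "{k}"])
      (auto simp: proj_def[abs_def] torus_inner_characters if_distrib[of "\<lambda>x. x * _"] cong: if_cong)
next
  case (cmult p c)
  show ?case using cmult.IH
  proof eventually_elim
    case (elim \<Lambda>)
    have "proj \<Lambda> (\<lambda>x. c * p x) x = c * proj \<Lambda> p x" for x
      by (simp add: proj_def torus_inner_cmult_left sum_distrib_left mult.assoc)
    then show ?case using elim by auto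
  qed
next
  case (add p q)
  show ?case using add.IH
  proof eventually_elim
    case (elim \<Lambda>)
    have "proj \<Lambda> (\<lambda>x. p x + q x) x = proj \<Lambda> p x + proj \<Lambda> q x" for x
      using add.hyps by (simp add: proj_def torus_inner_add_left bm_intros trig_poly_bounded_measurable algebra_simps sum.distrib)
    then show ?case using elim by auto
  qed
qed

section \<open>Completeness of the characters\<close>

lemma trig_poly_sum:
  "(\<And>i. i \<in> I \<Longrightarrow> trig_poly (u i)) \<Longrightarrow> trig_poly (\<lambda>x. \<Sum>i\<in>I. u i x)"
  by (induction I rule: infinite_finite_induct) (auto intro: trig_poly.add trig_poly_const)

text \<open>The image of the cube is the product of unit circles, with opposite faces glued; its
  real coordinates are cosines and sines.\<close>

definition torus_embedding :: "real ^ 'd \<Rightarrow> complex ^ 'd" where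
  "torus_embedding x = (\<chi> i. cis (2 * pi * vec_nth x i))"

lemma character_axis:
  "character (axis i 1) x = cis (2 * pi * vec_nth x i)"
  "character (- axis i 1) x = cis (- (2 * pi * vec_nth x i))"
proof -
  have "(\<Sum>j\<in>UNIV. real_of_int (vec_nth (axis i 1) j) * vec_nth x j) = vec_nth x i"
    by (simp add: axis_def if_distrib[of "\<lambda>t. real_of_int t * _"] cong: if_cong)
  then show "character (axis i 1) x = cis (2 * pi * vec_nth x i)"
    by (simp add: character_def)
  then show "character (- axis i 1) x = cis (- (2 * pi * vec_nth x i))"
    by (metis cis_cnj cnj_character)
qed

text \<open>Each real coordinate of the embedding is a combination of two characters, and products
  stay trigonometric because characters multiply to characters.\<close>

lemma trig_poly_real_polynomial_embedding:
  assumes "real_polynomial_function q"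
  shows "trig_poly (\<lambda>x. complex_of_real (q (torus_embedding x)))"
  using assms
proof (induction rule: real_polynomial_function.induct)
  case (linear l)
  have coord: "trig_poly (\<lambda>x. complex_of_real (inner (torus_embedding x) b))"
    if b: "b \<in> Basis" for b :: "complex ^ 'd"
  proof -
    obtain i u where bu: "b = axis i u" and u: "u = 1 \<or> u = \<i>"
      using b by (auto simp: Basis_vec_def Basis_complex_def)
    \<comment> \<open>Euler's formulas: \<open>u = 1\<close> picks the cosine and
      \<open>u = \<i>\<close> the sine, where \<open>- \<i> / 2\<close> is
      \<open>1 / (2 * \<i>)\<close>.\<close>
    have eq: "complex_of_real (inner (torus_embedding x) b) =
        (if u = 1 then 1 / 2 else - \<i> / 2) * character (axis i 1) x
        + (if u = 1 then 1 / 2 else \<i> / 2) * character (- axis i 1) x" for x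
      using u
      by (auto simp: bu inner_axis torus_embedding_def character_axis complex_eq_iff inner_complex_def)
    show ?thesis
      unfolding eq by (intro trig_poly.intros)
  qed
  have expand: "l z = (\<Sum>b\<in>Basis. inner z b * l b)" for z
  proof -
    have "l z = l (\<Sum>b\<in>Basis. inner z b *\<^sub>R b)"
      by (simp add: euclidean_representation)
    also have "\<dots> = (\<Sum>b\<in>Basis. inner z b * l b)"
      using bounded_linear.linear[OF linear] by (simp add: linear_sum linear_cmul)
    finally show ?thesis .
  qed
  have "(\<lambda>x. complex_of_real (l (torus_embedding x))) =
      (\<lambda>x. \<Sum>b\<in>Basis. complex_of_real (l b) * complex_of_real (inner (torus_embedding x) b))"
    by (rule ext, subst expand) (simp add: mult.commute)
  then show ?case
    using coord by (simp only:) (intro trig_poly_sum trig_poly.cmult)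
next
  case (const c)
  show ?case by (rule trig_poly_const)
next
  case (add p q)
  then show ?case using trig_poly.add by fastforce
next
  case (mult p q)
  then show ?case using trig_poly_mult by fastforce
qed

text \<open>Equal images force the coordinates to differ by an integer, and two distinct numbers in
  the unit interval at integer distance are its endpoints.\<close>

lemma torus_embedding_eqD:
  assumes "x \<in> torus" "y \<in> torus" "torus_embedding x = torus_embedding y" "vec_nth x i \<noteq> vec_nth y i"
  shows "vec_nth x i \<in> {0, 1}"
proof -
  have "cis (2 * pi * vec_nth x i) = cis (2 * pi * vec_nth y i)"
    using assms(3) by (auto simp: torus_embedding_def Finite_Cartesian_Product.vec_eq_iff)
  then have "sin (2 * pi * vec_nth x i) = sin (2 * pi * vec_nth y i) \<and>
      cos (2 * pi * vec_nth x i) = cos (2 * pi * vec_nth y i)"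
    by (simp add: complex_eq_iff)
  then obtain n :: int where "2 * pi * vec_nth x i = 2 * pi * vec_nth y i + 2 * pi * n"
    by (auto simp: sin_cos_eq_iff)
  then have n: "vec_nth x i = vec_nth y i + n"
    by (simp flip: distrib_left)
  have range: "0 \<le> vec_nth x i" "vec_nth x i \<le> 1" "0 \<le> vec_nth y i" "vec_nth y i \<le> 1"
    using assms(1,2) by (auto simp: mem_torus)
  then have "real_of_int n \<le> 1" "- 1 \<le> real_of_int n" using n by linarith+
  then have "n = 1 \<or> n = -1" using n assms(4) by (cases "n = 0") auto
  then show ?thesis using n range by auto
qed

lemma compact_torus: "compact torus"
  by (simp add: torus_def)

text \<open>Vanishing on the boundary of the cube makes \<open>h\<close> descend to the quotient torus, realised as
  the image of the cube in \<open>\<complex>\<^sup>d\<close>, where Stone--Weierstrass applies.\<close>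

lemma trig_poly_uniform_approx:
  fixes h :: "real ^ 'd \<Rightarrow> real"
  assumes cont: "continuous_on torus h"
    and bdry: "\<And>x i. x \<in> torus \<Longrightarrow> vec_nth x i \<in> {0, 1} \<Longrightarrow> h x = 0"
    and e: "0 < e"
  obtains p where "trig_poly p" "\<And>x. x \<in> torus \<Longrightarrow> cmod (complex_of_real (h x) - p x) < e"
proof -
  let ?S = "torus_embedding ` (torus :: (real ^ 'd) set)"
  have cont_emb: "continuous_on A (torus_embedding :: real ^ 'd \<Rightarrow> _)" for A
    unfolding torus_embedding_def by (intro continuous_intros)
  have compS: "compact ?S"
    by (intro compact_continuous_image cont_emb compact_torus)
  \<comment> \<open>\<open>H\<close> uses an arbitrary preimage in the cube. Two different preimages
    of one point both have a coordinate in \<open>{0, 1}\<close>, where \<open>h\<close> vanishes,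
    so the choice does not affect the value.\<close>
  define H where "H z = h (inv_into torus torus_embedding z)" for z
  have H: "H (torus_embedding x) = h x" if x: "x \<in> torus" for x
  proof -
    define y where "y = inv_into torus torus_embedding (torus_embedding x)"
    have y: "y \<in> torus" "torus_embedding y = torus_embedding x"
      unfolding y_def using x by (auto intro: inv_into_into f_inv_into_f)
    have "h y = h x"
    proof (cases "y = x")
      case False
      then obtain i where i: "vec_nth x i \<noteq> vec_nth y i"
        by (metis Finite_Cartesian_Product.vec_eq_iff)
      then have "vec_nth x i \<in> {0, 1}" "vec_nth y i \<in> {0, 1}"
        using torus_embedding_eqD[OF x y(1) y(2)[symmetric] i]
          torus_embedding_eqD[OF y(1) x y(2) i[symmetric]] by auto
      then show ?thesis using bdry x y by metis
    qed simp
    then show ?thesis by (simp add: H_def y_def)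
  qed
  \<comment> \<open>A continuous map on a compact set is closed onto its image, so \<open>H\<close>
    inherits continuity from \<open>h\<close>: preimages of closed sets under \<open>H\<close> are
    images of compact sets.\<close>
  have "continuous_on ?S H"
    unfolding continuous_on_closed_vimage[OF compact_imp_closed[OF compS]]
  proof (intro allI impI)
    fix B :: "real set" assume "closed B"
    then have "closed (h -` B \<inter> torus)"
      using cont continuous_on_closed_vimage[OF compact_imp_closed[OF compact_torus]] by blast
    then have "compact (h -` B \<inter> torus)"
      using compact_torus compact_Int_closed[of torus "h -` B \<inter> torus"] by (simp add: Int_commute Int_left_commute)
    then have "compact (torus_embedding ` (h -` B \<inter> torus))"
      by (intro compact_continuous_image cont_emb)
    moreover have "H -` B \<inter> ?S = torus_embedding ` (h -` B \<inter> torus)"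
      using H by auto
    ultimately show "closed (H -` B \<inter> ?S)"
      by (simp add: compact_imp_closed)
  qed
  then obtain q where q: "real_polynomial_function q" "\<And>z. z \<in> ?S \<Longrightarrow> \<bar>H z - q z\<bar> < e"
    using Stone_Weierstrass_real_polynomial_function[OF compS _ e] by blast
  show thesis
  proof (rule that)
    show "trig_poly (\<lambda>x. complex_of_real (q (torus_embedding x)))"
      by (rule trig_poly_real_polynomial_embedding[OF q(1)])
    show "cmod (complex_of_real (h x) - complex_of_real (q (torus_embedding x))) < e"
      if "x \<in> torus" for x
      using q(2)[of "torus_embedding x"] H[OF that] that
      by (simp flip: of_real_diff)
  qed
qed

text \<open>Measurability supplies continuous functions converging to \<open>f\<close> almost
  everywhere. Clamped to the unit interval and cut off at the boundary they still converge, by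
  dominated convergence also in L2, and each of them is uniformly approximable.\<close>

lemma trig_poly_dense:
  fixes f :: "real ^ 'd \<Rightarrow> real"
  assumes f: "f \<in> borel_measurable torus_measure" "f ` torus \<subseteq> {0..1}" and e: "0 < e"
  obtains p where "trig_poly p" "sq_norm (\<lambda>x. complex_of_real (f x) - p x) < e"
proof -
  have "(\<lambda>x. if x \<in> torus then f x else 0) \<in> borel_measurable lebesgue"
    using f(1) by (simp add: torus_measure_def borel_measurable_if)
  then have "(\<lambda>x. if x \<in> torus then f x else 0) measurable_on UNIV"
    by (intro lebesgue_measurable_imp_measurable_on_real) auto
  then obtain N F where N: "negligible N" and contF: "\<And>n. continuous_on UNIV (F n)"
    and limF: "\<And>x. x \<notin> N \<Longrightarrow> (\<lambda>n. F n x) \<longlonglongrightarrow> (if x \<in> torus then f x else 0)"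
    by (auto simp: measurable_on_def)
  \<comment> \<open>\<open>w\<close> is positive in the interior of the cube and zero on its
    boundary, so \<open>min 1 (real n * w x)\<close> is a cutoff that vanishes on the boundary and
    tends to 1 inside.\<close>
  define w :: "real ^ 'd \<Rightarrow> real" where "w x = (\<Prod>i\<in>UNIV. vec_nth x i * (1 - vec_nth x i))" for x
  define h where "h n x = min 1 (real n * w x) * max 0 (min 1 (F n x))" for n x
  have w_nonneg: "0 \<le> w x" if "x \<in> torus" for x
    using that unfolding w_def by (intro prod_nonneg) (auto simp: mem_torus)
  have h01: "h n ` torus \<subseteq> {0..1}" for n
    using w_nonneg by (auto simp: h_def intro!: mult_le_one)
  have conth: "continuous_on A (h n)" for A n
    unfolding h_def w_def
    by (intro continuous_intros continuous_on_subset[OF contF]) auto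
  have h_meas: "h n \<in> borel_measurable torus_measure" for n
  proof -
    have "h n \<in> borel_measurable borel"
      by (intro borel_measurable_continuous_onI conth)
    then have "h n \<in> borel_measurable lborel" by simp
    then show ?thesis
      unfolding torus_measure_def by (intro measurable_restrict_space1 measurable_completion)
  qed
  have h_bdry: "h n x = 0" if "vec_nth x i \<in> {0, 1}" for n x i
  proof -
    have "w x = 0" unfolding w_def using that by (intro prod_zero) auto
    then show ?thesis by (simp add: h_def)
  qed
  have bm_f: "bounded_measurable (\<lambda>x. complex_of_real (f x))"
    and bm_h: "bounded_measurable (\<lambda>x. complex_of_real (h n x))" for n
    using bounded_measurable_of_real[OF f] bounded_measurable_of_real[OF h_meas h01] by auto
  have lim: "(\<lambda>n. h n x) \<longlonglongrightarrow> f x" if x: "x \<in> box 0 1" "x \<notin> N" for x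
  proof -
    have xt: "x \<in> torus" using x(1) box_subset_cbox by (auto simp: torus_def)
    have wpos: "0 < w x"
      unfolding w_def using x(1) by (intro prod_pos) (auto simp: mem_box_cart)
    obtain n0 where n0: "1 / w x < real n0" using reals_Archimedean2 by blast
    have "eventually (\<lambda>n. min 1 (real n * w x) = 1) sequentially"
      using eventually_ge_at_top[of n0]
    proof eventually_elim
      case (elim n)
      then have "1 / w x \<le> real n" using n0 by linarith
      then show ?case using wpos by (simp add: field_simps)
    qed
    then have "(\<lambda>n. min 1 (real n * w x)) \<longlonglongrightarrow> 1"
      by (rule tendsto_eventually)
    moreover have "(\<lambda>n. max 0 (min 1 (F n x))) \<longlonglongrightarrow> max 0 (min 1 (f x))"
      using limF[OF x(2)] xt by (intro tendsto_intros) auto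
    ultimately have "(\<lambda>n. h n x) \<longlonglongrightarrow> 1 * max 0 (min 1 (f x))"
      unfolding h_def by (rule tendsto_mult)
    moreover have "max 0 (min 1 (f x)) = f x"
      using f(2) xt by (auto simp: max_def min_def)
    ultimately show ?thesis by simp
  qed
  \<comment> \<open>Convergence may fail on \<open>N\<close> and on the boundary of the cube, both
    of measure zero.\<close>
  have null: "N \<union> (cbox 0 1 - box 0 1) \<in> null_sets lebesgue"
    using N by (intro null_sets.Un) (auto simp: negligible_frontier_interval simp flip: negligible_iff_null_sets)
  have "AE x in torus_measure. (\<lambda>n. h n x) \<longlonglongrightarrow> f x"
    unfolding torus_measure_def
    by (subst AE_restrict_space_iff) (auto intro!: AE_I'[OF null] lim simp: torus_def)
  then have AElim: "AE x in torus_measure. (\<lambda>n. (cmod (complex_of_real (f x) - complex_of_real (h n x)))\<^sup>2) \<longlonglongrightarrow> 0"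
  proof eventually_elim
    case (elim x)
    have "(\<lambda>n. (cmod (complex_of_real (f x) - complex_of_real (h n x)))\<^sup>2)
        \<longlonglongrightarrow> (cmod (complex_of_real (f x) - complex_of_real (f x)))\<^sup>2"
      by (intro tendsto_intros elim)
    then show ?case by simp
  qed
  have "(\<lambda>n. sq_norm (\<lambda>x. complex_of_real (f x) - complex_of_real (h n x)))
      \<longlonglongrightarrow> (LINT x|(torus_measure :: (real ^ 'd) measure). 0)"
    unfolding sq_norm_def
  proof (rule integral_dominated_convergence[where w = "\<lambda>_. 1"])
    show "(\<lambda>x. (cmod (complex_of_real (f x) - complex_of_real (h n x)))\<^sup>2) \<in> borel_measurable torus_measure" for n
      using integrable_sq_norm[OF bounded_measurable_diff[OF bm_f bm_h]] by (rule borel_measurable_integrable)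
    show "AE x in torus_measure. norm ((cmod (complex_of_real (f x) - complex_of_real (h n x)))\<^sup>2) \<le> 1" for n
    proof (rule AE_I2)
      fix x :: "real ^ 'd" assume "x \<in> space torus_measure"
      then have "f x \<in> {0..1}" "h n x \<in> {0..1}" using f(2) h01[of n] by auto
      then have "\<bar>f x - h n x\<bar> \<le> 1" by auto
      then show "norm ((cmod (complex_of_real (f x) - complex_of_real (h n x)))\<^sup>2) \<le> 1"
        by (simp add: abs_square_le_1 flip: of_real_diff)
    qed
  qed (use AElim in auto)
  then have "(\<lambda>n. sq_norm (\<lambda>x. complex_of_real (f x) - complex_of_real (h n x))) \<longlonglongrightarrow> 0"
    by simp
  \<comment> \<open>With the factors 2 in \<open>sq_norm_add_le\<close>, each of the two errors may
    use up \<open>e / 4\<close>; the second comes from a uniform bound by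
    \<open>sqrt (e / 4)\<close>.\<close>
  then have "eventually (\<lambda>n. sq_norm (\<lambda>x. complex_of_real (f x) - complex_of_real (h n x)) < e / 4) sequentially"
    using e by (intro order_tendstoD(2)) auto
  then obtain n where n: "sq_norm (\<lambda>x. complex_of_real (f x) - complex_of_real (h n x)) < e / 4"
    by (auto simp: eventually_sequentially)
  obtain p where p: "trig_poly p" "\<And>x. x \<in> torus \<Longrightarrow> cmod (complex_of_real (h n x) - p x) < sqrt (e / 4)"
    using trig_poly_uniform_approx[OF conth, of n "sqrt (e / 4)"] h_bdry e by auto
  have "sq_norm (\<lambda>x. complex_of_real (h n x) - p x) \<le> sq_norm (\<lambda>_ :: real ^ 'd. complex_of_real (sqrt (e / 4)))"
    using p e by (intro sq_norm_mono bm_intros bm_h trig_poly_bounded_measurable) (auto simp: less_imp_le)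
  also have "\<dots> = e / 4"
    using e torus.prob_space[where 'd = 'd] by (simp add: sq_norm_def)
  finally have hp: "sq_norm (\<lambda>x. complex_of_real (h n x) - p x) \<le> e / 4" .
  have "sq_norm (\<lambda>x. complex_of_real (f x) - p x) =
      sq_norm (\<lambda>x. (complex_of_real (f x) - complex_of_real (h n x)) + (complex_of_real (h n x) - p x))"
    by simp
  also have "\<dots> \<le> 2 * sq_norm (\<lambda>x. complex_of_real (f x) - complex_of_real (h n x))
      + 2 * sq_norm (\<lambda>x. complex_of_real (h n x) - p x)"
    using p by (intro sq_norm_add_le bm_intros bm_f bm_h trig_poly_bounded_measurable)
  also have "\<dots> < e" using n hp by simp
  finally show thesis using that p(1) by blast
qed

section \<open>Moments\<close>

lemma sq_norm_minus_commute: "sq_norm (\<lambda>x. u x - v x) = sq_norm (\<lambda>x. v x - u x)"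
  by (simp add: sq_norm_def norm_minus_commute)

lemma proj_diff:
  assumes "bounded_measurable u" "bounded_measurable v"
  shows "proj \<Lambda> (\<lambda>x. u x - v x) x = proj \<Lambda> u x - proj \<Lambda> v x"
  using assms
  by (simp add: proj_def torus_inner_diff_left bm_intros left_diff_distrib sum_subtractf)

text \<open>If the projection fixes a trigonometric polynomial \<open>p\<close> near
  \<open>f\<close>, then replacing \<open>f\<close> by \<open>f - p\<close> leaves the projection
  error unchanged, and that error is at most the norm of \<open>f - p\<close>.\<close>

lemma sq_norm_diff_proj_tendsto:
  fixes f :: "real ^ 'd \<Rightarrow> real"
  assumes f: "f \<in> borel_measurable torus_measure" "f ` torus \<subseteq> {0..1}"
  shows "((\<lambda>\<Lambda>. sq_norm (\<lambda>x. complex_of_real (f x) - proj \<Lambda> (\<lambda>x. complex_of_real (f x)) x)) \<longlongrightarrow> 0)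
    (finite_subsets_at_top UNIV)"
proof (rule order_tendstoI)
  fix e :: real assume "0 < e"
  then obtain p where p: "trig_poly p" "sq_norm (\<lambda>x. complex_of_real (f x) - p x) < e"
    using trig_poly_dense[OF f] by blast
  have bm: "bounded_measurable (\<lambda>x. complex_of_real (f x))" "bounded_measurable p"
    using bounded_measurable_of_real[OF f] trig_poly_bounded_measurable[OF p(1)] by auto
  have fin: "eventually finite (finite_subsets_at_top (UNIV :: (int ^ 'd) set))"
    by (rule eventually_finite_subsets_at_top_weakI)
  show "eventually (\<lambda>\<Lambda>. sq_norm (\<lambda>x. complex_of_real (f x) - proj \<Lambda> (\<lambda>x. complex_of_real (f x)) x) < e)
      (finite_subsets_at_top UNIV)"
    using eventually_proj_trig_poly[OF p(1)] fin
  proof eventually_elim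
    case (elim \<Lambda>)
    have "sq_norm (\<lambda>x. complex_of_real (f x) - proj \<Lambda> (\<lambda>x. complex_of_real (f x)) x) =
        sq_norm (\<lambda>x. (complex_of_real (f x) - p x) - proj \<Lambda> (\<lambda>x. complex_of_real (f x) - p x) x)"
      using elim(1) bm by (simp add: proj_diff)
    also have "\<dots> \<le> sq_norm (\<lambda>x. complex_of_real (f x) - p x)"
      using elim bm by (intro sq_norm_diff_proj_le bm_intros) auto
    finally show ?case using p(2) by simp
  qed
qed (auto intro!: always_eventually less_le_trans[OF _ sq_norm_nonneg])

text \<open>The iteration starts from the constant 1, which is \<open>character 0\<close> and so
  lies in the range of the projection for every finite \<open>\<Lambda>\<close> containing
  0.\<close>

primrec compressed_power :: "(int ^ 'd) set \<Rightarrow> (real ^ 'd \<Rightarrow> real) \<Rightarrow> nat \<Rightarrow> real ^ 'd \<Rightarrow> complex" where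
  "compressed_power \<Lambda> f 0 = (\<lambda>_. 1)"
| "compressed_power \<Lambda> f (Suc m) = proj \<Lambda> (\<lambda>x. complex_of_real (f x) * compressed_power \<Lambda> f m x)"

lemma bounded_measurable_compressed_power [bm_intros]: "bounded_measurable (compressed_power \<Lambda> f m)"
  by (cases m) (auto intro!: bm_intros)

text \<open>Multiplication by \<open>f\<close> and projection are L2-contractions, so the error of
  stage \<open>m\<close> is passed on with at most the factor 2 from \<open>sq_norm_add_le\<close>.
  The only new error is that of projecting the fixed function \<open>f x ^ Suc m\<close>.\<close>

lemma compressed_power_tendsto:
  fixes f :: "real ^ 'd \<Rightarrow> real"
  assumes f: "f \<in> borel_measurable torus_measure" "f ` torus \<subseteq> {0..1}"
  shows "((\<lambda>\<Lambda>. sq_norm (\<lambda>x. compressed_power \<Lambda> f m x - complex_of_real (f x ^ m))) \<longlongrightarrow> 0)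
    (finite_subsets_at_top UNIV)"
proof (induction m)
  case 0
  show ?case by (simp add: sq_norm_def)
next
  case (Suc m)
  let ?f = "\<lambda>x. complex_of_real (f x)"
  let ?g = "\<lambda>m x. complex_of_real (f x ^ m)"
  have pow: "(\<lambda>x. f x ^ m) \<in> borel_measurable torus_measure" "(\<lambda>x. f x ^ m) ` torus \<subseteq> {0..1}" for m
    using f by (auto intro!: power_le_one)
  have bm: "bounded_measurable ?f" "bounded_measurable (?g m)" for m
    using bounded_measurable_of_real[OF f] bounded_measurable_of_real[OF pow] by auto
  have le: "sq_norm (\<lambda>x. compressed_power \<Lambda> f (Suc m) x - ?g (Suc m) x) \<le>
      2 * sq_norm (\<lambda>x. compressed_power \<Lambda> f m x - ?g m x)
      + 2 * sq_norm (\<lambda>x. ?g (Suc m) x - proj \<Lambda> (?g (Suc m)) x)"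
    if fin: "finite \<Lambda>" for \<Lambda>
  proof -
    let ?U = "compressed_power \<Lambda> f m"
    have *: "proj \<Lambda> (\<lambda>x. ?f x * (?U x - ?g m x)) x = proj \<Lambda> (\<lambda>x. ?f x * ?U x) x - proj \<Lambda> (?g (Suc m)) x" for x
      using proj_diff[of "\<lambda>x. ?f x * ?U x" "?g (Suc m)" \<Lambda> x] bm
      by (simp add: bm_intros right_diff_distrib)
    have "sq_norm (\<lambda>x. compressed_power \<Lambda> f (Suc m) x - ?g (Suc m) x) =
      sq_norm (\<lambda>x. proj \<Lambda> (\<lambda>x. ?f x * (?U x - ?g m x)) x + (proj \<Lambda> (?g (Suc m)) x - ?g (Suc m) x))"
      unfolding * by simp
    also have "\<dots> \<le> 2 * sq_norm (proj \<Lambda> (\<lambda>x. ?f x * (?U x - ?g m x)))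
        + 2 * sq_norm (\<lambda>x. proj \<Lambda> (?g (Suc m)) x - ?g (Suc m) x)"
      by (intro sq_norm_add_le bm_intros bm)
    also have "sq_norm (\<lambda>x. proj \<Lambda> (?g (Suc m)) x - ?g (Suc m) x) =
        sq_norm (\<lambda>x. ?g (Suc m) x - proj \<Lambda> (?g (Suc m)) x)"
      by (rule sq_norm_minus_commute)
    also have "sq_norm (proj \<Lambda> (\<lambda>x. ?f x * (?U x - ?g m x))) \<le> sq_norm (\<lambda>x. ?f x * (?U x - ?g m x))"
      by (intro sq_norm_proj_le fin bm_intros bm)
    also have "\<dots> \<le> sq_norm (\<lambda>x. ?U x - ?g m x)"
    proof (intro sq_norm_mono bm_intros bm)
      fix x :: "real ^ 'd" assume "x \<in> torus"
      then have "\<bar>f x\<bar> \<le> 1" using f(2) by auto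
      then show "cmod (?f x * (?U x - ?g m x)) \<le> cmod (?U x - ?g m x)"
        by (simp add: norm_mult mult_left_le_one_le)
    qed
    finally show ?thesis by simp
  qed
  have "((\<lambda>\<Lambda>. 2 * sq_norm (\<lambda>x. compressed_power \<Lambda> f m x - ?g m x)
      + 2 * sq_norm (\<lambda>x. ?g (Suc m) x - proj \<Lambda> (?g (Suc m)) x)) \<longlongrightarrow> 2 * 0 + 2 * 0)
      (finite_subsets_at_top UNIV)"
    by (intro tendsto_intros Suc.IH sq_norm_diff_proj_tendsto pow)
  then have lim: "((\<lambda>\<Lambda>. 2 * sq_norm (\<lambda>x. compressed_power \<Lambda> f m x - ?g m x)
      + 2 * sq_norm (\<lambda>x. ?g (Suc m) x - proj \<Lambda> (?g (Suc m)) x)) \<longlongrightarrow> 0)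
      (finite_subsets_at_top UNIV)"
    by simp
  show ?case
  proof (rule tendsto_sandwich[OF _ _ tendsto_const lim])
    show "eventually (\<lambda>\<Lambda>. sq_norm (\<lambda>x. compressed_power \<Lambda> f (Suc m) x - ?g (Suc m) x) \<le>
        2 * sq_norm (\<lambda>x. compressed_power \<Lambda> f m x - ?g m x)
        + 2 * sq_norm (\<lambda>x. ?g (Suc m) x - proj \<Lambda> (?g (Suc m)) x)) (finite_subsets_at_top UNIV)"
      by (rule eventually_finite_subsets_at_top_weakI) (rule le)
  qed (simp add: sq_norm_nonneg)
qed

text \<open>On a probability space the modulus of an integral is at most the L2-norm, so
  L2-convergence passes to the integrals.\<close>

lemma integral_compressed_power_tendsto:
  fixes f :: "real ^ 'd \<Rightarrow> real"
  assumes f: "f \<in> borel_measurable torus_measure" "f ` torus \<subseteq> {0..1}"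
  shows "((\<lambda>\<Lambda>. LINT x|torus_measure. compressed_power \<Lambda> f m x) \<longlongrightarrow>
    complex_of_real (LINT x|torus_measure. f x ^ m)) (finite_subsets_at_top UNIV)"
proof -
  have "(\<lambda>x. f x ^ m) \<in> borel_measurable torus_measure" "(\<lambda>x. f x ^ m) ` torus \<subseteq> {0..1}"
    using f by (auto intro!: power_le_one)
  then have bm: "bounded_measurable (\<lambda>x. complex_of_real (f x ^ m))"
    by (rule bounded_measurable_of_real)
  have le: "cmod ((LINT x|torus_measure. compressed_power \<Lambda> f m x) - complex_of_real (LINT x|torus_measure. f x ^ m))
      \<le> sqrt (sq_norm (\<lambda>x. compressed_power \<Lambda> f m x - complex_of_real (f x ^ m)))" for \<Lambda>
  proof -
    have "(LINT x|torus_measure. compressed_power \<Lambda> f m x) - complex_of_real (LINT x|torus_measure. f x ^ m) =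
        (LINT x|torus_measure. compressed_power \<Lambda> f m x - complex_of_real (f x ^ m))"
      using bounded_measurable_integrable[OF bm]
        bounded_measurable_integrable[OF bounded_measurable_compressed_power, of \<Lambda> f m]
      by (simp flip: integral_complex_of_real)
    then show ?thesis
      using norm_integral_le_sq_norm[OF bounded_measurable_diff[OF bounded_measurable_compressed_power bm], of \<Lambda> f m]
      by (simp add: real_le_rsqrt)
  qed
  have "((\<lambda>\<Lambda>. sqrt (sq_norm (\<lambda>x. compressed_power \<Lambda> f m x - complex_of_real (f x ^ m)))) \<longlongrightarrow> sqrt 0)
      (finite_subsets_at_top UNIV)"
    by (rule tendsto_real_sqrt[OF compressed_power_tendsto[OF f]])
  then have lim: "((\<lambda>\<Lambda>. sqrt (sq_norm (\<lambda>x. compressed_power \<Lambda> f m x - complex_of_real (f x ^ m)))) \<longlongrightarrow> 0)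
      (finite_subsets_at_top UNIV)"
    by (simp only: real_sqrt_zero)
  have "((\<lambda>\<Lambda>. (LINT x|torus_measure. compressed_power \<Lambda> f m x) -
      complex_of_real (LINT x|torus_measure. f x ^ m)) \<longlongrightarrow> 0) (finite_subsets_at_top UNIV)"
    by (rule Lim_null_comparison[OF always_eventually lim]) (intro allI le)
  then show ?thesis by (rule LIM_zero_cancel)
qed

text \<open>In the basis of characters, multiplication by \<open>f\<close> followed by projection
  has the finite Toeplitz section as its matrix. The assumption \<open>0 \<in> \<Lambda>\<close>
  makes the initial constant 1 a basis vector.\<close>

lemma compressed_power_eq_window_iter:
  assumes fin: "finite \<Lambda>" and 0: "0 \<in> \<Lambda>"
    and f: "bounded_measurable (\<lambda>x. complex_of_real (f x))"
  shows "compressed_power \<Lambda> f m x =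
    (\<Sum>k\<in>\<Lambda>. window_iter \<Lambda> (\<lambda>j k. fourier_coeff f (j - k)) 0 m k * character k x)"
proof (induction m arbitrary: x)
  case 0
  show ?case using fin \<open>0 \<in> \<Lambda>\<close>
    by (simp add: if_distrib[of "\<lambda>x. x * _"] cong: if_cong)
next
  case (Suc m)
  let ?w = "window_iter \<Lambda> (\<lambda>j k. fourier_coeff f (j - k)) 0 m"
  have shift: "torus_inner (\<lambda>x. complex_of_real (f x) * character k x) (character j) = fourier_coeff f (j - k)" for j k
    by (simp add: fourier_coeff_eq_inner torus_inner_def cnj_character mult.assoc flip: character_add)
  have "torus_inner (\<lambda>x. complex_of_real (f x) * compressed_power \<Lambda> f m x) (character j) =
      torus_inner (\<lambda>x. \<Sum>k\<in>\<Lambda>. ?w k * (complex_of_real (f x) * character k x)) (character j)" for j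
    by (simp add: Suc.IH sum_distrib_left mult_ac)
  also have "\<dots> j = (\<Sum>k\<in>\<Lambda>. ?w k * torus_inner (\<lambda>x. complex_of_real (f x) * character k x) (character j))" for j
    using f by (simp add: torus_inner_sum_left bm_intros torus_inner_cmult_left)
  also have "\<dots> j = (\<Sum>k\<in>\<Lambda>. ?w k * fourier_coeff f (j - k))" for j
    by (simp only: shift)
  finally show ?case
    by (simp add: proj_def mult.commute)
qed

text \<open>Integration extracts the coefficient at \<open>character 0\<close>, a diagonal entry of
  a power of the finite section. Equal minors make these entries agree for every finite
  \<open>\<Lambda>\<close> containing 0, and the moments are their limits.\<close>

lemma moments_eq_of_perm_det_eq:
  fixes f g :: "real ^ 'd \<Rightarrow> real"
  assumes f: "f \<in> borel_measurable torus_measure" "f ` torus \<subseteq> {0..1}"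
    and g: "g \<in> borel_measurable torus_measure" "g ` torus \<subseteq> {0..1}"
    and minors: "\<And>T. finite T \<Longrightarrow>
      perm_det T (\<lambda>j k. fourier_coeff f (j - k)) = perm_det T (\<lambda>j k. fourier_coeff g (j - k))"
  shows "(LINT x|torus_measure. f x ^ m) = (LINT x|torus_measure. g x ^ m)"
proof -
  have int: "(LINT x|torus_measure. compressed_power \<Lambda> u m x) =
      window_iter \<Lambda> (\<lambda>j k. fourier_coeff u (j - k)) 0 m 0"
    if "finite \<Lambda>" "0 \<in> \<Lambda>" "u \<in> borel_measurable torus_measure" "u ` torus \<subseteq> {0..1}" for \<Lambda> u
  proof -
    have "(LINT x|torus_measure. compressed_power \<Lambda> u m x) =
      (\<Sum>k\<in>\<Lambda>. window_iter \<Lambda> (\<lambda>j k. fourier_coeff u (j - k)) 0 m k * (LINT x|torus_measure. character k x))"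
      using that
      by (simp add: compressed_power_eq_window_iter bounded_measurable_of_real
          bounded_measurable_integrable bm_intros)
    then show ?thesis
      using that(1,2) by (simp add: integral_character if_distrib[of "\<lambda>x. _ * x"] cong: if_cong)
  qed
  have "eventually (\<lambda>\<Lambda>. (LINT x|torus_measure. compressed_power \<Lambda> f m x) =
      (LINT x|torus_measure. compressed_power \<Lambda> g m x)) (finite_subsets_at_top UNIV)"
    unfolding eventually_finite_subsets_at_top
  proof (intro exI[of _ "{0}"] conjI allI impI)
    fix \<Lambda> :: "(int ^ 'd) set" assume "finite \<Lambda> \<and> {0} \<subseteq> \<Lambda> \<and> \<Lambda> \<subseteq> UNIV"
    then have \<Lambda>: "finite \<Lambda>" "0 \<in> \<Lambda>" by auto
    then show "(LINT x|torus_measure. compressed_power \<Lambda> f m x) =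
      (LINT x|torus_measure. compressed_power \<Lambda> g m x)"
      using window_iter_eq_of_perm_det_eq[OF \<Lambda> minors[OF finite_subset[OF _ \<Lambda>(1)]], of m]
      by (simp add: int f g)
  qed auto
  then have "((\<lambda>\<Lambda>. LINT x|torus_measure. compressed_power \<Lambda> f m x) \<longlongrightarrow>
    complex_of_real (LINT x|torus_measure. g x ^ m)) (finite_subsets_at_top UNIV)"
    using integral_compressed_power_tendsto[OF g, of m] tendsto_cong by fastforce
  then have "complex_of_real (LINT x|torus_measure. f x ^ m) = complex_of_real (LINT x|torus_measure. g x ^ m)"
    using integral_compressed_power_tendsto[OF f, of m]
    by (intro tendsto_unique[OF finite_subsets_at_top_neq_bot])
  then show ?thesis by (simp only: of_real_eq_iff)
qed

section \<open>Distributions on the unit interval determined by their moments\<close>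

context
  fixes M :: "'a measure" and f g :: "'a \<Rightarrow> real"
  assumes M: "finite_measure M"
    and f: "f \<in> borel_measurable M" "f ` space M \<subseteq> {0..1}"
    and g: "g \<in> borel_measurable M" "g ` space M \<subseteq> {0..1}"
    and moments: "\<And>m. (LINT x|M. f x ^ m) = (LINT x|M. g x ^ m)"
begin

text \<open>By linearity the moments determine the integrals of polynomials, which are uniformly
  dense in the continuous functions on the unit interval, where both functions take their
  values.\<close>

lemma integral_continuous_eq_of_moments_eq:
  fixes \<psi> :: "real \<Rightarrow> real"
  assumes \<psi>: "continuous_on UNIV \<psi>"
  shows "(LINT x|M. \<psi> (f x)) = (LINT x|M. \<psi> (g x))"
proof -
  interpret finite_measure M by (rule M)
  have int: "integrable M (\<lambda>x. \<phi> (u x))"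
    if "continuous_on UNIV \<phi>" "u \<in> borel_measurable M" "u ` space M \<subseteq> {0..1}"
    for \<phi> :: "real \<Rightarrow> real" and u
  proof -
    have "compact (\<phi> ` {0..1})"
      using that(1) by (intro compact_continuous_image) (auto intro: continuous_on_subset)
    then obtain B where "\<forall>t\<in>{0..1}. norm (\<phi> t) \<le> B"
      by (auto dest!: compact_imp_bounded simp: bounded_iff)
    then show ?thesis
      using that by (intro integrable_const_bound[where B = B] AE_I2)
        (auto intro: borel_measurable_continuous_on)
  qed
  have le: "\<bar>(LINT x|M. \<psi> (f x)) - (LINT x|M. \<psi> (g x))\<bar> \<le> e" if e: "0 < e" for e
  proof -
    \<comment> \<open>The total mass times \<open>e / c\<close> is at most \<open>e / 2\<close>, one
      half for each of \<open>f\<close> and \<open>g\<close>; the summand 1 keeps \<open>c\<close>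
      positive even if the mass is 0.\<close>
    define c where "c = 2 * (measure M (space M) + 1)"
    have c: "0 < c" by (simp add: c_def add_nonneg_pos)
    obtain q where q: "real_polynomial_function q" "\<And>t. t \<in> {0..1} \<Longrightarrow> \<bar>\<psi> t - q t\<bar> < e / c"
      using Stone_Weierstrass_real_polynomial_function[OF compact_Icc continuous_on_subset[OF \<psi> subset_UNIV]
          divide_pos_pos[OF e c], of 0 1] by blast
    have contq: "continuous_on UNIV q"
      using q(1) real_polynomial_function_eq continuous_on_polymonial_function by blast
    have close: "\<bar>(LINT x|M. \<psi> (u x)) - (LINT x|M. q (u x))\<bar> \<le> e / 2"
      if u: "u \<in> borel_measurable M" "u ` space M \<subseteq> {0..1}" for u
    proof -
      have "\<bar>(LINT x|M. \<psi> (u x)) - (LINT x|M. q (u x))\<bar> = \<bar>LINT x|M. \<psi> (u x) - q (u x)\<bar>"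
        using int[OF \<psi> u] int[OF contq u] by simp
      also have "\<dots> \<le> (LINT x|M. \<bar>\<psi> (u x) - q (u x)\<bar>)"
        by (rule integral_abs_bound)
      also have "\<dots> \<le> (LINT x|M. e / c)"
        using int[OF \<psi> u] int[OF contq u] q(2) u(2)
        by (intro integral_mono) (auto intro!: less_imp_le)
      also have "\<dots> \<le> e / 2"
        using e c by (simp add: c_def field_simps)
      finally show ?thesis .
    qed
    obtain a n where q_sum: "q = (\<lambda>t. \<Sum>i\<le>n. a i * t ^ i)"
      using q(1) real_polynomial_function_iff_sum by blast
    have pow: "integrable M (\<lambda>x. u x ^ i)" if "u \<in> borel_measurable M" "u ` space M \<subseteq> {0..1}"
      for u :: "'a \<Rightarrow> real" and i
      by (rule int[of "\<lambda>t. t ^ i", OF _ that]) (intro continuous_intros)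
    have "(LINT x|M. q (f x)) = (LINT x|M. q (g x))"
      unfolding q_sum using f g by (simp add: pow moments)
    then show ?thesis using close[OF f] close[OF g] by linarith
  qed
  have "\<bar>(LINT x|M. \<psi> (f x)) - (LINT x|M. \<psi> (g x))\<bar> \<le> 0"
    by (rule field_le_epsilon, unfold add_0_left, rule le)
  then show ?thesis by simp
qed

text \<open>The indicator of a closed half-line is a pointwise limit of bounded continuous ramps,
  and dominated convergence carries the equality of integrals over to it.\<close>

lemma measure_superlevel_eq_of_moments_eq:
  "measure M {x \<in> space M. \<xi> \<le> f x} = measure M {x \<in> space M. \<xi> \<le> g x}"
proof -
  interpret finite_measure M by (rule M)
  \<comment> \<open>For positive \<open>n\<close> the ramp rises from 0 at
    \<open>\<xi> - 1 / n\<close> to 1 at \<open>\<xi>\<close>. Placing it to the left of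
    \<open>\<xi>\<close> gives the limit 1 at \<open>\<xi>\<close> itself, as the weak inequality
    demands.\<close>
  define \<psi> where "\<psi> n t = max 0 (min 1 (1 + real n * (t - \<xi>)))" for n t
  have cont: "continuous_on UNIV (\<psi> n)" for n
    unfolding \<psi>_def by (intro continuous_intros)
  have \<psi>_lim: "(\<lambda>n. \<psi> n t) \<longlonglongrightarrow> indicator {\<xi>..} t" for t
  proof (cases "\<xi> \<le> t")
    case True
    then show ?thesis by (simp add: \<psi>_def)
  next
    case False
    obtain n0 where n0: "1 / (\<xi> - t) < real n0" using reals_Archimedean2 by blast
    have "eventually (\<lambda>n. \<psi> n t = 0) sequentially"
      using eventually_ge_at_top[of n0]
    proof eventually_elim
      case (elim n)
      then have "1 / (\<xi> - t) \<le> real n" using n0 by linarith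
      then have "1 / (\<xi> - t) * (\<xi> - t) \<le> real n * (\<xi> - t)"
        using False by (intro mult_right_mono) auto
      moreover have "1 / (\<xi> - t) * (\<xi> - t) = 1" using False by simp
      ultimately have "1 + real n * (t - \<xi>) \<le> 0" by (simp add: right_diff_distrib)
      then show ?case by (simp add: \<psi>_def)
    qed
    then show ?thesis using False by (simp add: tendsto_eventually)
  qed
  have lim: "(\<lambda>n. LINT x|M. \<psi> n (u x)) \<longlonglongrightarrow> measure M {x \<in> space M. \<xi> \<le> u x}"
    if u: "u \<in> borel_measurable M" for u
  proof -
    have [measurable]: "\<psi> n \<in> borel_measurable borel" for n
      by (intro borel_measurable_continuous_onI cont)
    note [measurable] = u
    have "(\<lambda>n. LINT x|M. \<psi> n (u x)) \<longlonglongrightarrow> (LINT x|M. indicator {\<xi>..} (u x))"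
    proof (rule integral_dominated_convergence[where w = "\<lambda>_. 1"])
      show "AE x in M. norm (\<psi> n (u x)) \<le> 1" for n
        by (auto simp: \<psi>_def)
    qed (use \<psi>_lim in auto)
    also have "(LINT x|M. indicator {\<xi>..} (u x)) = (LINT x|M. indicator {x \<in> space M. \<xi> \<le> u x} x :: real)"
      by (intro Bochner_Integration.integral_cong) (auto simp: indicator_def)
    also have "\<dots> = measure M {x \<in> space M. \<xi> \<le> u x}"
      by simp
    finally show ?thesis .
  qed
  show ?thesis
    using lim[OF f(1)] lim[OF g(1)] integral_continuous_eq_of_moments_eq[OF cont]
    by (simp add: LIMSEQ_unique)
qed

end

theorem proposition1p7:
  fixes f g :: "real ^ 'd \<Rightarrow> real"
    and P Q :: "(int ^ 'd) set measure"
  assumes "f \<in> borel_measurable torus_measure" and "f ` torus \<subseteq> {0..1}"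
    and "g \<in> borel_measurable torus_measure" and "g ` torus \<subseteq> {0..1}"
    and "determinantal_law f P" and "determinantal_law g Q"
    and "P = Q"
  shows "value_distribution f = value_distribution g"
proof -
  \<comment> \<open>The law speaks of distinct lists; an enumeration of \<open>T\<close> turns this
    into a statement about minors indexed by sets.\<close>
  have minor: "perm_det T (\<lambda>j k. fourier_coeff u (j - k)) = complex_of_real (measure R {S. T \<subseteq> S})"
    if u: "determinantal_law u R" and T: "finite T" for u :: "real ^ 'd \<Rightarrow> real" and R T
  proof -
    obtain ks where "distinct ks" "set ks = T"
      using finite_distinct_list[OF T] by blast
    then show ?thesis
      using u det_mat_nth_eq_perm_det[of ks "\<lambda>j k. fourier_coeff u (j - k)"]
      by (auto simp: determinantal_law_def)
  qed
  have "(LINT x|torus_measure. f x ^ m) = (LINT x|torus_measure. g x ^ m)" for m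
    using assms minor by (intro moments_eq_of_perm_det_eq) auto
  then have "value_distribution f \<xi> = value_distribution g \<xi>" for \<xi>
    using measure_superlevel_eq_of_moments_eq[of torus_measure f g \<xi>] assms(1-4)
      torus.finite_measure_axioms
    by (simp add: value_distribution_def)
  then show ?thesis by blast
qed

end
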